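(* Let the functions $f_\ell$, $\ell\ge 1$, be defined for $x\in[-1,1]$ by $$f_1(x)=\sin\left(\frac{\pi}{2}x\right),\qquad f_\ell(x)=f_{\ell-1}(x)+\frac1\pi\sin\left(\pi f_{\ell-1}(x)\right),\quad \ell\ge 2.$$ Then for all $\ell\ge 1$: (1) $f_\ell$ maps $[-1,1]$ into $[-1,1]$; (2) $f_\ell$ is strictly increasing on $[-1,1]$; (3) $f_\ell(-x)=-f_\ell(x)$ for all $x\in[-1,1]$. Moreover, for every $x\in[-1,1]$, $$\lim_{\ell\to\infty}f_\ell(x)=\mathrm{sgn}(x),$$ and for any $p\in(0,\infty)$ there exists a constant $C_p>0$, depending only on $p$, such that for all $\ell\ge 1$ $$\|\mathrm{sgn}-f_\ell\|_{L^p(-1,1)}\le C_p\,2^{-\ell/p}.$$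
   Context: The sign function is $\mathrm{sgn}(x)=1$ for $0<x\le 1$, $\mathrm{sgn}(0)=0$, and $\mathrm{sgn}(x)=-1$ for $-1\le x<0$. For $p\in(0,\infty)$, $\|g\|_{L^p(-1,1)}=\left(\int_{-1}^1|g(x)|^p\,dx\right)^{1/p}$ (a quasi-norm when $p<1$). *)

theory Defs
  imports "HOL-Analysis.Analysis"
begin

text \<open>
  The sequence is indexed from 1; the value at index 0 is an arbitrary dummy that does not
  enter the recursion.
\<close>

fun sgn_approx :: "nat \<Rightarrow> real \<Rightarrow> real" where
  "sgn_approx 0 x = 0"
| "sgn_approx (Suc 0) x = sin (pi / 2 * x)"
| "sgn_approx (Suc (Suc n)) x =
     sgn_approx (Suc n) x + 1 / pi * sin (pi * sgn_approx (Suc n) x)"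

text \<open>
  The integral defaults to 0 when \<open>\<bar>g\<bar>\<close> to the power \<open>p\<close> is not integrable, so bounds on
  \<open>Lp_norm p g\<close> are meaningful only together with \<open>in_Lp p g\<close>.
\<close>

definition in_Lp :: "real \<Rightarrow> (real \<Rightarrow> real) \<Rightarrow> bool" where
  "in_Lp p g \<longleftrightarrow>
     set_borel_measurable lebesgue {-1<..<1} g \<and>
     set_integrable lebesgue {-1<..<1} (\<lambda>x. \<bar>g x\<bar> powr p)"

definition Lp_norm :: "real \<Rightarrow> (real \<Rightarrow> real) \<Rightarrow> real" where
  "Lp_norm p g = (LINT x:{-1<..<1}|lebesgue. \<bar>g x\<bar> powr p) powr (1 / p)"

end

theory Submission
  imports Defs
begin

text \<open>
  The map \<open>F y = y + sin (pi * y) / pi\<close>, of which the sequence consists of iterates, has a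
  superattracting fixed point at 1. The whole theorem rests on one explicit form of this, valid on
  all of \<open>[0, 1]\<close> and with constant 1:
  \<open>1 - F y \<le> (1 - y)\<^sup>2\<close> (lemma \<open>sgn_step_error_le\<close>).
  It follows from Jordan's inequality \<open>x \<le> sin (pi / 2 * x)\<close>, which also says that the initial
  error \<open>1 - f\<^sub>1 x\<close> is at most \<open>1 - x\<close>. Squaring the error at each step gives, by oddness on both
  sides of the origin,
  \<open>\<bar>sgn x - f\<^sub>l x\<bar> \<le> (1 - \<bar>x\<bar>) ^ 2 ^ (l - 1)\<close> (lemma \<open>sgn_approx_error_le\<close>).

  Since \<open>1 - \<bar>x\<bar> < 1\<close> away from the origin, pointwise convergence is immediate. For the norm,
  the \<open>p\<close>-th power of the bound is \<open>(1 - \<bar>x\<bar>)\<close> to the power \<open>a = p * 2 ^ (l - 1)\<close>, whose integral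
  over \<open>(-1, 1)\<close> is \<open>2 / (a + 1) \<le> (4 / p) * 2 powr (- l)\<close>; taking \<open>p\<close>-th roots gives the claim
  with \<open>C = (4 / p) powr (1 / p)\<close>, for all \<open>p > 0\<close> alike. Monotonicity, oddness and invariance of
  \<open>[-1, 1]\<close> pass from \<open>F\<close> and from the sine to the iterates by induction.
\<close>

section \<open>Jordan's inequality and a parabola below the sine\<close>

text \<open>The sine is concave on \<open>[0, pi / 2]\<close>, so its graph lies above the chord there.\<close>

lemma jordan_sin_ge:
  fixes x :: real
  assumes "0 \<le> x" "x \<le> 1"
  shows "x \<le> sin (pi / 2 * x)"
proof -
  have "concave_on {0..pi / 2} sin"
  proof (rule f''_le0_imp_concave)
    show "(sin has_real_derivative cos t) (at t)" for t :: real
      by (rule DERIV_sin)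
    show "(cos has_real_derivative - sin t) (at t)" for t :: real
      by (auto intro!: derivative_eq_intros)
    show "- sin t \<le> 0" if "t \<in> {0..pi / 2}" for t
      using that by (auto intro!: sin_ge_zero)
  qed auto
  then have "(1 - x) * sin 0 + x * sin (pi / 2) \<le> sin ((1 - x) *\<^sub>R 0 + x *\<^sub>R (pi / 2))"
    using assms by (intro concave_onD) auto
  then show ?thesis
    by (simp add: mult.commute)
qed

text \<open>
  Both sides are symmetric about \<open>1 / 2\<close> and vanish at 0. On the left half their difference is
  nondecreasing, because Jordan's inequality, read for the cosine, is \<open>1 - 2 * y \<le> cos (pi * y)\<close>.
\<close>

lemma parabola_le_sin_pi:
  fixes y :: real
  assumes "0 \<le> y" "y \<le> 1"
  shows "y * (1 - y) \<le> sin (pi * y) / pi"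
proof -
  have half: "z * (1 - z) \<le> sin (pi * z) / pi" if "0 \<le> z" "z \<le> 1 / 2" for z :: real
  proof -
    define h where "h t = sin (pi * t) / pi - t * (1 - t)" for t :: real
    have "h 0 \<le> h z"
    proof (rule DERIV_nonneg_imp_nondecreasing[where f = h])
      fix t assume t: "0 \<le> t" "t \<le> z"
      have "(h has_real_derivative cos (pi * t) - (1 - 2 * t)) (at t)"
        unfolding h_def by (auto intro!: derivative_eq_intros simp: algebra_simps)
      moreover have "1 - 2 * t \<le> cos (pi * t)"
      proof -
        have "1 - 2 * t \<le> sin (pi / 2 * (1 - 2 * t))"
          using t that by (intro jordan_sin_ge) auto
        also have "pi / 2 * (1 - 2 * t) = pi / 2 - pi * t"
          by (simp add: field_simps)
        finally show ?thesis
          by (simp add: cos_sin_eq)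
      qed
      ultimately show "\<exists>d. (h has_real_derivative d) (at t) \<and> 0 \<le> d"
        by auto
    qed (use that in simp)
    then show ?thesis
      by (simp add: h_def)
  qed
  show ?thesis
  proof (cases "y \<le> 1 / 2")
    case True
    then show ?thesis using half assms by simp
  next
    case False
    have "sin (pi * (1 - y)) = sin (pi * y)"
      by (simp add: right_diff_distrib sin_diff)
    then show ?thesis
      using half[of "1 - y"] assms False by (simp add: mult.commute)
  qed
qed

section \<open>The iteration map\<close>

definition sgn_step :: "real \<Rightarrow> real" where
  "sgn_step y = y + 1 / pi * sin (pi * y)"

lemma sgn_approx_Suc: "1 \<le> l \<Longrightarrow> sgn_approx (Suc l) x = sgn_step (sgn_approx l x)"
  by (cases l) (auto simp: sgn_step_def)

text \<open>
  On \<open>[-1, 1]\<close> the derivative \<open>1 + cos (pi * y)\<close> vanishes at the two endpoints only, which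
  leaves the map strictly increasing on the closed interval.
\<close>

lemma strict_mono_on_sgn_step: "strict_mono_on {-1..1} sgn_step"
proof (rule strict_mono_onI)
  fix a b :: real
  assume ab: "a \<in> {-1..1}" "b \<in> {-1..1}" "a < b"
  show "sgn_step a < sgn_step b"
  proof (rule DERIV_pos_imp_increasing_open[OF \<open>a < b\<close>])
    fix x assume x: "a < x" "x < b"
    have "cos pi < cos \<bar>pi * x\<bar>"
      using x ab by (intro cos_monotone_0_pi) (auto simp: abs_mult)
    moreover have "(sgn_step has_real_derivative 1 + cos (pi * x)) (at x)"
      unfolding sgn_step_def by (auto intro!: derivative_eq_intros)
    ultimately show "\<exists>d. (sgn_step has_real_derivative d) (at x) \<and> 0 < d"
      by (auto intro!: exI[of _ "1 + cos (pi * x)"])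
  next
    show "continuous_on {a..b} sgn_step"
      unfolding sgn_step_def by (intro continuous_intros)
  qed
qed

lemma sgn_step_in_interval:
  assumes "y \<in> {-1..1}"
  shows "sgn_step y \<in> {-1..1}"
proof -
  have "sgn_step (-1) \<le> sgn_step y" "sgn_step y \<le> sgn_step 1"
    using assms by (auto intro!: strict_mono_on_leD[OF strict_mono_on_sgn_step])
  then show ?thesis
    by (simp add: sgn_step_def)
qed

lemma sgn_step_minus: "sgn_step (- y) = - sgn_step y"
  by (simp add: sgn_step_def)

text \<open>Quadratic convergence to 1, in the form that survives iteration without loss.\<close>

lemma sgn_step_error_le:
  assumes "0 \<le> y" "y \<le> 1"
  shows "1 - sgn_step y \<le> (1 - y)\<^sup>2"
  using parabola_le_sin_pi[OF assms]
  by (simp add: sgn_step_def power2_eq_square algebra_simps)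

section \<open>The approximating sequence\<close>

lemma sgn_approx_in_interval:
  assumes "1 \<le> l"
  shows "sgn_approx l x \<in> {-1..1}"
  using assms
proof (induction l rule: nat_induct_at_least)
  case (Suc l)
  then show ?case using sgn_step_in_interval by (simp add: sgn_approx_Suc)
qed simp

lemma strict_mono_on_sgn_approx:
  assumes "1 \<le> l"
  shows "strict_mono_on {-1..1} (sgn_approx l)"
  using assms
proof (induction l rule: nat_induct_at_least)
  case base
  have "sin (pi / 2 * a) < sin (pi / 2 * b)" if "-1 \<le> a" "a < b" "b \<le> 1" for a b
  proof (rule sin_monotone_2pi)
    show "- (pi / 2) \<le> pi / 2 * a"
      using mult_left_mono[OF that(1), of "pi / 2"] by simp
    show "pi / 2 * b \<le> pi / 2"
      using mult_left_mono[OF that(3), of "pi / 2"] by simp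
  qed (use that in simp)
  then show ?case
    by (auto intro!: strict_mono_onI)
next
  case (Suc l)
  show ?case
  proof (rule strict_mono_onI)
    fix a b :: real
    assume "a \<in> {-1..1}" "b \<in> {-1..1}" "a < b"
    then show "sgn_approx (Suc l) a < sgn_approx (Suc l) b"
      using Suc sgn_approx_in_interval[OF Suc.hyps]
      by (simp only: sgn_approx_Suc[OF Suc.hyps])
        (blast intro: strict_mono_onD[OF strict_mono_on_sgn_step] strict_mono_onD[OF Suc.IH])
  qed
qed

lemma sgn_approx_minus:
  assumes "1 \<le> l"
  shows "sgn_approx l (- x) = - sgn_approx l x"
  using assms
  by (induction l rule: nat_induct_at_least) (simp_all add: sgn_approx_Suc sgn_step_minus)

lemma continuous_on_sgn_approx: "continuous_on A (sgn_approx l)"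
proof (induction l rule: induct_nat_012)
  case 0
  have "sgn_approx 0 = (\<lambda>x. 0)" by auto
  then show ?case by simp
next
  case 1
  have "sgn_approx (Suc 0) = (\<lambda>x. sin (pi / 2 * x))" by auto
  then show ?case by (simp add: continuous_intros)
next
  case (ge2 n)
  have "sgn_approx (Suc (Suc n)) =
      (\<lambda>x. sgn_approx (Suc n) x + 1 / pi * sin (pi * sgn_approx (Suc n) x))"
    by auto
  then show ?case using ge2 by (simp add: continuous_intros)
qed

text \<open>
  Each step squares the bound of the previous one, starting from Jordan's inequality. The two
  bounds are proved together because squaring is applicable only to an iterate in \<open>[0, 1]\<close>.
\<close>

lemma sgn_approx_right_bounds:
  assumes "1 \<le> l" "0 \<le> x" "x \<le> 1"
  shows "0 \<le> sgn_approx l x \<and> 1 - sgn_approx l x \<le> (1 - x) ^ 2 ^ (l - 1)"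
  using assms(1)
proof (induction l rule: nat_induct_at_least)
  case base
  then show ?case
    using jordan_sin_ge[OF assms(2,3)] assms(2) by simp
next
  case (Suc l)
  let ?y = "sgn_approx l x"
  have y: "0 \<le> ?y" "?y \<le> 1"
    using Suc sgn_approx_in_interval[of l x] by auto
  have "sgn_step 0 \<le> sgn_step ?y"
    using y by (intro strict_mono_on_leD[OF strict_mono_on_sgn_step]) auto
  then have "0 \<le> sgn_step ?y"
    by (simp add: sgn_step_def)
  moreover have "1 - sgn_step ?y \<le> (1 - ?y)\<^sup>2"
    by (rule sgn_step_error_le[OF y])
  moreover have "(1 - ?y)\<^sup>2 \<le> ((1 - x) ^ 2 ^ (l - 1))\<^sup>2"
    using Suc y by (intro power_mono) auto
  moreover have "((1 - x) ^ 2 ^ (l - 1))\<^sup>2 = (1 - x) ^ 2 ^ (Suc l - 1)"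
    using Suc.hyps by (simp add: power_mult [symmetric] power_Suc2 [symmetric] del: power_Suc)
  ultimately show ?case
    using sgn_approx_Suc[OF Suc.hyps, of x] by simp
qed

lemma sgn_approx_error_le:
  assumes "1 \<le> l" "\<bar>x\<bar> \<le> 1"
  shows "\<bar>sgn x - sgn_approx l x\<bar> \<le> (1 - \<bar>x\<bar>) ^ 2 ^ (l - 1)"
proof -
  have pos: "\<bar>1 - sgn_approx l z\<bar> \<le> (1 - z) ^ 2 ^ (l - 1)" if "0 < z" "z \<le> 1" for z
    using sgn_approx_right_bounds[of l z] sgn_approx_in_interval[of l z] assms(1) that by auto
  consider "x = 0" | "x > 0" | "x < 0" by linarith
  then show ?thesis
  proof cases
    case 1
    have "sgn_approx l 0 = 0"
      using sgn_approx_minus[OF assms(1), of 0] by simp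
    then show ?thesis using 1 by simp
  next
    case 2
    then show ?thesis using pos[of x] assms by simp
  next
    case 3
    then show ?thesis
      using pos[of "- x"] assms sgn_approx_minus[OF assms(1), of x]
      by (simp add: abs_minus_commute)
  qed
qed

lemma sgn_approx_tendsto_sgn:
  assumes "\<bar>x\<bar> \<le> 1"
  shows "(\<lambda>l. sgn_approx l x) \<longlonglongrightarrow> sgn x"
proof (cases "x = 0")
  case True
  have "sgn_approx l 0 = 0" for l
    using sgn_approx_minus[of l 0] by (cases l) auto
  then show ?thesis using True by simp
next
  case False
  let ?q = "1 - \<bar>x\<bar>"
  have "(\<lambda>l. sgn x - sgn_approx l x) \<longlonglongrightarrow> 0"
  proof (rule Lim_null_comparison)
    show "\<forall>\<^sub>F l in sequentially. norm (sgn x - sgn_approx l x) \<le> ?q ^ (l - 1)"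
      using eventually_ge_at_top[of 1]
    proof eventually_elim
      case (elim l)
      have "\<bar>sgn x - sgn_approx l x\<bar> \<le> ?q ^ 2 ^ (l - 1)"
        by (rule sgn_approx_error_le[OF elim assms])
      also have "\<dots> \<le> ?q ^ (l - 1)"
        using assms by (intro power_decreasing) (auto intro: less_imp_le less_exp)
      finally show ?case by simp
    qed
    have "(\<lambda>l. ?q ^ l) \<longlonglongrightarrow> 0"
      using assms False by (intro LIMSEQ_realpow_zero) auto
    then show "(\<lambda>l. ?q ^ (l - 1)) \<longlonglongrightarrow> 0"
      by (subst filterlim_sequentially_Suc [symmetric]) simp
  qed
  then show ?thesis
    using tendsto_diff[OF tendsto_const[of "sgn x"]] by fastforce
qed

section \<open>The rate in the mean\<close>

lemma has_integral_one_minus_abs_powr: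
  fixes a :: real
  assumes "0 \<le> a"
  shows "((\<lambda>x. (1 - \<bar>x\<bar>) powr a) has_integral 2 / (a + 1)) {-1..1}"
proof -
  have "((\<lambda>x. x powr a) has_integral 1 / (a + 1)) {0..1}"
    using has_integral_powr_from_0[of a 1] assms by simp
  then have "((\<lambda>x. (x + 1) powr a) has_integral 1 / (a + 1)) {-1..0}"
    using has_integral_shift_real_ivl[of "\<lambda>x. x powr a" "1 / (a + 1)" 0 1 1] by simp
  then have left: "((\<lambda>x. (1 - \<bar>x\<bar>) powr a) has_integral 1 / (a + 1)) {-1..0}"
    by (rule has_integral_eq[rotated]) (simp add: add.commute)
  then have right: "((\<lambda>x. (1 - \<bar>x\<bar>) powr a) has_integral 1 / (a + 1)) {0..1}"
    using has_integral_reflect_real[of "\<lambda>x. (1 - \<bar>x\<bar>) powr a" "1 / (a + 1)" 1 0]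
      has_integral_reflect_real[of "\<lambda>x. (1 - \<bar>x\<bar>) powr a" "1 / (a + 1)" 0 1] by simp
  show ?thesis
    using has_integral_combine[OF _ _ left right] by simp
qed

lemma set_integral_one_minus_abs_powr:
  fixes a :: real
  assumes "0 \<le> a"
  shows "set_integrable lebesgue {-1<..<1} (\<lambda>x. (1 - \<bar>x\<bar>) powr a)"
    and "(LINT x:{-1<..<1}|lebesgue. (1 - \<bar>x\<bar>) powr a) = 2 / (a + 1)"
proof -
  have I: "((\<lambda>x. (1 - \<bar>x\<bar>) powr a) has_integral 2 / (a + 1)) {-1<..<1}"
    using has_integral_one_minus_abs_powr[OF assms] by (simp add: has_integral_Icc_iff_Ioo)
  then show int: "set_integrable lebesgue {-1<..<1} (\<lambda>x. (1 - \<bar>x\<bar>) powr a)"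
    by (intro nonnegative_absolutely_integrable_1) (auto intro: has_integral_integrable)
  show "(LINT x:{-1<..<1}|lebesgue. (1 - \<bar>x\<bar>) powr a) = 2 / (a + 1)"
    using set_lebesgue_integral_eq_integral(2)[OF int] integral_unique[OF I] by simp
qed

lemma borel_measurable_sgn_minus_sgn_approx:
  "(\<lambda>x. sgn x - sgn_approx l x) \<in> borel_measurable borel"
proof -
  have [measurable]: "sgn_approx l \<in> borel_measurable borel"
    by (intro borel_measurable_continuous_onI continuous_on_sgn_approx)
  show ?thesis by measurable
qed

lemma sgn_approx_error_powr_le:
  assumes "1 \<le> l" "0 < p" "x \<in> {-1<..<1}"
  shows "\<bar>sgn x - sgn_approx l x\<bar> powr p \<le> (1 - \<bar>x\<bar>) powr (p * 2 ^ (l - 1))"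
proof -
  have x: "0 < 1 - \<bar>x\<bar>" using assms(3) by auto
  have "\<bar>sgn x - sgn_approx l x\<bar> powr p \<le> ((1 - \<bar>x\<bar>) ^ 2 ^ (l - 1)) powr p"
    using assms x by (intro powr_mono2 sgn_approx_error_le) auto
  also have "\<dots> = (1 - \<bar>x\<bar>) powr (p * 2 ^ (l - 1))"
    using x by (simp add: powr_realpow [symmetric] powr_powr mult.commute)
  finally show ?thesis .
qed

lemma in_Lp_sgn_minus_sgn_approx:
  assumes "1 \<le> l" "0 < p"
  shows "in_Lp p (\<lambda>x. sgn x - sgn_approx l x)"
  unfolding in_Lp_def
proof
  note [measurable] = borel_measurable_sgn_minus_sgn_approx[of l]
  show "set_borel_measurable lebesgue {-1<..<1} (\<lambda>x. sgn x - sgn_approx l x)"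
    unfolding set_borel_measurable_def
    by (rule measurable_completion) measurable
  show "set_integrable lebesgue {-1<..<1} (\<lambda>x. \<bar>sgn x - sgn_approx l x\<bar> powr p)"
  proof (rule set_integrable_bound)
    show "set_integrable lebesgue {-1<..<1} (\<lambda>x. (1 - \<bar>x\<bar>) powr (p * 2 ^ (l - 1)))"
      using assms by (intro set_integral_one_minus_abs_powr) auto
    show "set_borel_measurable lebesgue {-1<..<1} (\<lambda>x. \<bar>sgn x - sgn_approx l x\<bar> powr p)"
      unfolding set_borel_measurable_def
      by (rule measurable_completion) measurable
    show "AE x in lebesgue. x \<in> {-1<..<1} \<longrightarrow>
        norm (\<bar>sgn x - sgn_approx l x\<bar> powr p) \<le> norm ((1 - \<bar>x\<bar>) powr (p * 2 ^ (l - 1)))"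
      using sgn_approx_error_powr_le[OF assms] by simp
  qed
qed

lemma Lp_norm_sgn_minus_sgn_approx_le:
  assumes "1 \<le> l" "0 < p"
  shows "Lp_norm p (\<lambda>x. sgn x - sgn_approx l x)
      \<le> (4 / p) powr (1 / p) * 2 powr (- real l / p)"
proof -
  let ?a = "p * 2 ^ (l - 1)"
  let ?I = "LINT x:{-1<..<1}|lebesgue. \<bar>sgn x - sgn_approx l x\<bar> powr p"
  have a: "0 < ?a" using assms by simp
  have "?I \<le> (LINT x:{-1<..<1}|lebesgue. (1 - \<bar>x\<bar>) powr ?a)"
    using in_Lp_sgn_minus_sgn_approx[OF assms] sgn_approx_error_powr_le[OF assms] a
    by (intro set_integral_mono set_integral_one_minus_abs_powr(1)) (auto simp: in_Lp_def)
  also have "\<dots> = 2 / (?a + 1)"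
    using a by (intro set_integral_one_minus_abs_powr(2)) simp
  also have "\<dots> \<le> 2 / ?a"
    using a by (intro divide_left_mono) auto
  also have "\<dots> = 4 / p * 2 powr (- real l)"
  proof -
    have "(2::real) powr (- real l) = inverse (2 ^ l)"
      by (simp add: powr_minus powr_realpow)
    moreover have "(2::real) ^ l = 2 * 2 ^ (l - 1)"
      using assms by (cases l) auto
    ultimately show ?thesis
      using assms by (simp add: field_simps)
  qed
  finally have "?I \<le> 4 / p * 2 powr (- real l)" .
  moreover have "0 \<le> ?I"
    unfolding set_lebesgue_integral_def by (rule Bochner_Integration.integral_nonneg) simp
  ultimately have "?I powr (1 / p) \<le> (4 / p * 2 powr (- real l)) powr (1 / p)"
    using assms by (intro powr_mono2) auto
  also have "\<dots> = (4 / p) powr (1 / p) * 2 powr (- real l / p)"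
    using assms by (subst powr_mult) (auto simp: powr_powr)
  finally show ?thesis
    unfolding Lp_norm_def .
qed

theorem theorem1:
  shows "(\<forall>l\<ge>1. sgn_approx l ` {-1..1} \<subseteq> {-1..1}
            \<and> strict_mono_on {-1..1} (sgn_approx l)
            \<and> (\<forall>x\<in>{-1..1}. sgn_approx l (- x) = - sgn_approx l x))
       \<and> (\<forall>x\<in>{-1..1}. (\<lambda>l. sgn_approx l x) \<longlonglongrightarrow> sgn x)
       \<and> (\<forall>p>0. \<exists>C>0. \<forall>l\<ge>1.
            in_Lp p (\<lambda>x. sgn x - sgn_approx l x)
            \<and> Lp_norm p (\<lambda>x. sgn x - sgn_approx l x) \<le> C * 2 powr (- real l / p))"
proof (intro conjI allI impI ballI)
  fix l :: nat assume l: "1 \<le> l"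
  show "sgn_approx l ` {-1..1} \<subseteq> {-1..1}"
    using sgn_approx_in_interval[OF l] by blast
  show "strict_mono_on {-1..1} (sgn_approx l)"
    by (rule strict_mono_on_sgn_approx[OF l])
  show "sgn_approx l (- x) = - sgn_approx l x" for x
    by (rule sgn_approx_minus[OF l])
next
  fix x :: real assume "x \<in> {-1..1}"
  then show "(\<lambda>l. sgn_approx l x) \<longlonglongrightarrow> sgn x"
    by (intro sgn_approx_tendsto_sgn) auto
next
  fix p :: real assume p: "0 < p"
  show "\<exists>C>0. \<forall>l\<ge>1. in_Lp p (\<lambda>x. sgn x - sgn_approx l x)
            \<and> Lp_norm p (\<lambda>x. sgn x - sgn_approx l x) \<le> C * 2 powr (- real l / p)"
    using p in_Lp_sgn_minus_sgn_approx Lp_norm_sgn_minus_sgn_approx_le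
    by (intro exI[of _ "(4 / p) powr (1 / p)"]) auto
qed

end
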